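(* Let $k\ge2$ be an integer and $0<\varepsilon<1$. Run the following procedure: set $L=\{g^{(0)}\}$ with $g^{(0)}(x)=(k-1)x$, and $z=1$; then repeat: $t\leftarrow z+\sqrt{z(k-z)\varepsilon}$; $z\leftarrow\frac{t}{1+\varepsilon}+\frac{k\varepsilon}{2(1+\varepsilon)}+\frac{1}{2(1+\varepsilon)}\big(k^2\varepsilon^2+4\varepsilon t(k-t)\big)^{1/2}$; if $t>k/2$ add to $L$ the line tangent to $\zeta(x)=x(k-x)$ at $x=k/2$ (the constant function $k^2/4$), otherwise add $g_t(x)=kx-2tx+t^2$ (the line tangent to $\zeta$ at $t$); and stop as soon as $z\ge k/2$. Then the output satisfies $|L|=O\big(\varepsilon^{-1/2}\log\log\frac1\varepsilon\big)$, with an implied constant independent of $k$ and $\varepsilon$.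
   Context: Asymptotic notation in $\varepsilon$ refers to the regime $\varepsilon\to0$. *)

theory Defs
  imports Complex_Main "HOL-Library.While_Combinator"
begin

definition zeta :: "nat \<Rightarrow> real \<Rightarrow> real" where
  "zeta k x = x * (real k - x)"

definition tangent_line :: "nat \<Rightarrow> real \<Rightarrow> real \<Rightarrow> real" where
  "tangent_line k t x = real k * x - 2 * t * x + t\<^sup>2"

lemma tangent_line_eq:
  "tangent_line k t x = zeta k t + (real k - 2 * t) * (x - t)"
  by (simp add: tangent_line_def zeta_def algebra_simps power2_eq_square)

lemma zeta_has_derivative:
  "(zeta k has_real_derivative (real k - 2 * t)) (at t)"
  unfolding zeta_def by (auto intro!: derivative_eq_intros)

lemma tangent_line_half: "tangent_line k (real k / 2) = (\<lambda>x. (real k)\<^sup>2 / 4)"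
  by (rule ext) (simp add: tangent_line_def power2_eq_square)

definition next_t :: "nat \<Rightarrow> real \<Rightarrow> real \<Rightarrow> real" where
  "next_t k \<epsilon> z = z + sqrt (z * (real k - z) * \<epsilon>)"

definition next_z :: "nat \<Rightarrow> real \<Rightarrow> real \<Rightarrow> real" where
  "next_z k \<epsilon> t = t / (1 + \<epsilon>) + real k * \<epsilon> / (2 * (1 + \<epsilon>))
     + 1 / (2 * (1 + \<epsilon>)) * sqrt ((real k)\<^sup>2 * \<epsilon>\<^sup>2 + 4 * \<epsilon> * t * (real k - t))"

(* A line is represented by its graph function, so the cardinality of a set of lines
   counts distinct lines. *)
type_synonym state = "(real \<Rightarrow> real) set \<times> real"

definition init_state :: "nat \<Rightarrow> state" where
  "init_state k = ({\<lambda>x. (real k - 1) * x}, 1)"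

definition loop_body :: "nat \<Rightarrow> real \<Rightarrow> state \<Rightarrow> state" where
  "loop_body k \<epsilon> = (\<lambda>(L, z). let t = next_t k \<epsilon> z in
     (insert (if t > real k / 2 then (\<lambda>x. (real k)\<^sup>2 / 4) else tangent_line k t) L,
      next_z k \<epsilon> t))"

(* A repeat-until loop: the body runs once before the exit test is first made, which
   matters for k = 2, where z = k/2 holds initially. The value None means that the
   loop does not terminate. *)
definition final_lines :: "nat \<Rightarrow> real \<Rightarrow> (real \<Rightarrow> real) set option" where
  "final_lines k \<epsilon> = map_option fst
     (while_option (\<lambda>(L, z). \<not> z \<ge> real k / 2) (loop_body k \<epsilon>) (loop_body k \<epsilon> (init_state k)))"

end

theory Submission
  imports Defs
begin

text \<open>
  Whatever the starting point, one pass brings \<open>z\<close> to at least \<open>k \<epsilon> / 2\<close>. From there on every pass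
  with \<open>z \<le> k / 2\<close> increases \<open>sqrt z\<close> by at least \<open>sqrt (k \<epsilon> / 2) / 4\<close>, so \<open>sqrt z\<close> reaches
  \<open>sqrt (k / 2)\<close> within \<open>4 / sqrt \<epsilon>\<close> further passes. The number of lines is therefore already
  \<open>O(1 / sqrt \<epsilon>)\<close>, without the double logarithm.
\<close>

text \<open>This places \<open>t\<close> in the range where \<open>t * (k - t)\<close> is
  nonnegative, as \<open>next_z_bounds\<close> requires. For the upper bound, z (k - z) is at most
  its maximum k^2/4, so z \<le> k/2 grows by at most k/2.\<close>

lemma next_t_bounds:
  assumes "0 \<le> z" "z \<le> real k / 2" "0 < \<epsilon>" "\<epsilon> < 1"
  shows "0 \<le> next_t k \<epsilon> z" "next_t k \<epsilon> z \<le> real k"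
proof -
  have nonneg: "0 \<le> z * (real k - z)"
    using assms by simp
  then show "0 \<le> next_t k \<epsilon> z"
    using assms by (simp add: next_t_def)
  have "z * (real k - z) * \<epsilon> \<le> z * (real k - z)"
    using nonneg assms by (simp add: mult_left_le)
  also have "\<dots> \<le> (real k / 2)\<^sup>2"
    using zero_le_power2[of "z - real k / 2"] by (simp add: power2_eq_square algebra_simps)
  finally have "sqrt (z * (real k - z) * \<epsilon>) \<le> real k / 2"
    by (intro real_le_lsqrt) simp_all
  then show "next_t k \<epsilon> z \<le> real k"
    using assms by (simp add: next_t_def)
qed

text \<open>Dropping the nonnegative term 4 \<epsilon> t (k - t) from the radicand leaves a root of
  at least k \<epsilon>, hence (1 + \<epsilon>) \<open>next_z\<close> \<ge> t + k \<epsilon>. The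
  first bound then uses t \<le> k, the second \<epsilon> < 1.\<close>

lemma next_z_bounds:
  assumes "0 \<le> t" "t \<le> real k" "0 < \<epsilon>" "\<epsilon> < 1"
  shows "t \<le> next_z k \<epsilon> t" "real k * \<epsilon> / 2 \<le> next_z k \<epsilon> t"
proof -
  define r where "r = sqrt ((real k)\<^sup>2 * \<epsilon>\<^sup>2 + 4 * \<epsilon> * t * (real k - t))"
  have "(real k * \<epsilon>)\<^sup>2 \<le> (real k)\<^sup>2 * \<epsilon>\<^sup>2 + 4 * \<epsilon> * t * (real k - t)"
    using assms by (simp add: power_mult_distrib)
  then have "real k * \<epsilon> \<le> r"
    unfolding r_def by (rule real_le_rsqrt)
  moreover have "next_z k \<epsilon> t = (t + real k * \<epsilon> / 2 + r / 2) / (1 + \<epsilon>)"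
    by (simp add: next_z_def r_def add_divide_distrib)
  ultimately have key: "t + real k * \<epsilon> \<le> (1 + \<epsilon>) * next_z k \<epsilon> t"
    using assms by simp
  have "t * \<epsilon> \<le> real k * \<epsilon>"
    using assms by simp
  then have "(1 + \<epsilon>) * t \<le> (1 + \<epsilon>) * next_z k \<epsilon> t"
    using key by (simp add: algebra_simps)
  then show "t \<le> next_z k \<epsilon> t"
    using assms by simp
  have "real k * \<epsilon> * \<epsilon> \<le> real k * \<epsilon>"
    using assms by (intro mult_left_le) auto
  moreover have "(1 + \<epsilon>) * (real k * \<epsilon> / 2) = real k * \<epsilon> / 2 + real k * \<epsilon> * \<epsilon> / 2"
    by (simp add: algebra_simps)
  ultimately have "(1 + \<epsilon>) * (real k * \<epsilon> / 2) \<le> (1 + \<epsilon>) * next_z k \<epsilon> t"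
    using key assms by linarith
  then show "real k * \<epsilon> / 2 \<le> next_z k \<epsilon> t"
    using assms by simp
qed

text \<open>Put s = sqrt (k \<epsilon> / 2). As k - z \<ge> k/2, the increment of z is at least s
  sqrt z. With s \<le> sqrt z, this exceeds the cross term and square in (sqrt z + s/4)^2, because
  1/2 + 1/16 \<le> 1.\<close>

lemma sqrt_next_t_ge:
  assumes "real k * \<epsilon> / 2 \<le> z" "z \<le> real k / 2" "0 < \<epsilon>"
  shows "sqrt z + sqrt (real k * \<epsilon> / 2) / 4 \<le> sqrt (next_t k \<epsilon> z)"
proof (rule real_le_rsqrt)
  define s where "s = sqrt (real k * \<epsilon> / 2)"
  have nonneg: "0 \<le> real k * \<epsilon> / 2"
    using assms by simp
  then have z: "0 \<le> z"
    using assms by linarith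
  have s: "0 \<le> s" "s \<le> sqrt z"
    using assms z by (auto simp: s_def)
  have "z * (real k / 2 * \<epsilon>) \<le> z * ((real k - z) * \<epsilon>)"
    using assms z by (intro mult_left_mono mult_right_mono) auto
  then have "sqrt (z * (real k * \<epsilon> / 2)) \<le> sqrt (z * (real k - z) * \<epsilon>)"
    by (simp add: mult.assoc)
  then have "sqrt z * s \<le> sqrt (z * (real k - z) * \<epsilon>)"
    by (simp only: s_def real_sqrt_mult)
  moreover have "s * s \<le> sqrt z * s"
    using s by (intro mult_right_mono) auto
  moreover have "0 \<le> s * s"
    by simp
  moreover have "(sqrt z + s / 4)\<^sup>2 = z + sqrt z * s / 2 + s * s / 16"
    using z by (simp add: power2_sum power_divide flip: power2_eq_square)
  ultimately have "(sqrt z + s / 4)\<^sup>2 \<le> next_t k \<epsilon> z"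
    unfolding next_t_def by linarith
  then show "(sqrt z + sqrt (real k * \<epsilon> / 2) / 4)\<^sup>2 \<le> next_t k \<epsilon> z"
    by (simp add: s_def)
qed

text \<open>Here \<open>n\<close> is a budget of remaining passes: the last assumption says that
  \<open>n\<close> gains of the guaranteed size carry sqrt z to its target. A pass spends one unit
  and adds at most one line; with no budget left the exit test already holds. Termination and the
  count thus come from one induction.\<close>

lemma loop_lines_bound:
  assumes "0 < \<epsilon>" "\<epsilon> < 1" "finite L" "real k * \<epsilon> / 2 \<le> z"
    and "sqrt (real k / 2) \<le> sqrt z + real n * (sqrt (real k * \<epsilon> / 2) / 4)"
  shows "\<exists>L'. map_option fst (while_option (\<lambda>(L, z). \<not> z \<ge> real k / 2) (loop_body k \<epsilon>) (L, z))
                = Some L' \<and> finite L' \<and> card L' \<le> card L + n"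
  using assms(3-)
proof (induction n arbitrary: L z)
  case 0
  then show ?case
    by (subst while_option_unfold) simp
next
  case (Suc n)
  show ?case
  proof (cases "z \<ge> real k / 2")
    case True
    then show ?thesis
      using Suc.prems by (subst while_option_unfold) simp
  next
    case False
    define t where "t = next_t k \<epsilon> z"
    define L1 where "L1 =
      insert (if t > real k / 2 then (\<lambda>x. (real k)\<^sup>2 / 4) else tangent_line k t) L"
    have body: "loop_body k \<epsilon> (L, z) = (L1, next_z k \<epsilon> t)"
      by (simp add: loop_body_def Let_def t_def L1_def)
    have "0 \<le> real k * \<epsilon> / 2"
      using assms by simp
    with Suc.prems have "0 \<le> z"
      by linarith
    then have t: "0 \<le> t" "t \<le> real k"
      using next_t_bounds[of z k \<epsilon>] False assms(1,2) by (auto simp: t_def)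
    note z' = next_z_bounds[OF t assms(1,2)]
    have "sqrt z + sqrt (real k * \<epsilon> / 2) / 4 \<le> sqrt t"
      using sqrt_next_t_ge[of k \<epsilon> z] Suc.prems False assms(1) by (simp add: t_def)
    also have "sqrt t \<le> sqrt (next_z k \<epsilon> t)"
      using z' by simp
    finally have "sqrt (real k / 2)
        \<le> sqrt (next_z k \<epsilon> t) + real n * (sqrt (real k * \<epsilon> / 2) / 4)"
      using Suc.prems(3) by (simp add: algebra_simps add_divide_distrib)
    moreover have "finite L1"
      using Suc.prems by (simp add: L1_def)
    ultimately obtain L' where L':
      "map_option fst (while_option (\<lambda>(L, z). \<not> z \<ge> real k / 2) (loop_body k \<epsilon>)
         (L1, next_z k \<epsilon> t)) = Some L'"
      "finite L'" "card L' \<le> card L1 + n"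
      using Suc.IH[of L1 "next_z k \<epsilon> t"] z' by blast
    have "card L1 \<le> Suc (card L)"
      using Suc.prems(1) by (simp add: L1_def card_insert_if)
    then show ?thesis
      using L' False by (subst while_option_unfold) (auto simp: body)
  qed
qed

lemma final_lines_bound:
  assumes "2 \<le> k" "0 < \<epsilon>" "\<epsilon> < 1"
  shows "\<exists>L. final_lines k \<epsilon> = Some L \<and> finite L \<and> real (card L) \<le> 7 / sqrt \<epsilon>"
proof -
  define t where "t = next_t k \<epsilon> 1"
  define L1 where "L1 = insert (if t > real k / 2 then (\<lambda>x. (real k)\<^sup>2 / 4) else tangent_line k t)
    {\<lambda>x. (real k - 1) * x}"
  \<comment> \<open>The distance sqrt (k/2) divided by the gain sqrt (k \<epsilon> / 2) / 4 per pass
    is 4 / sqrt \<epsilon>. The factor k cancels, which makes the bound uniform in k.\<close>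
  define n where "n = nat \<lceil>4 / sqrt \<epsilon>\<rceil>"
  have body: "loop_body k \<epsilon> (init_state k) = (L1, next_z k \<epsilon> t)"
    by (simp add: loop_body_def Let_def init_state_def t_def L1_def)
  \<comment> \<open>The initial z = 1 is at most k/2 because k \<ge> 2. This pass, run before the
    first exit test, establishes the lower bound k \<epsilon> / 2 on z that the induction
    needs.\<close>
  have t: "0 \<le> t" "t \<le> real k"
    using next_t_bounds[of 1 k \<epsilon>] assms by (auto simp: t_def)
  note z = next_z_bounds[OF t assms(2,3)]
  have n: "4 / sqrt \<epsilon> \<le> real n" "real n \<le> 4 / sqrt \<epsilon> + 1"
    using assms(2) by (auto simp: n_def of_nat_nat intro: less_imp_le)
  have "4 \<le> real n * sqrt \<epsilon>"
    using n(1) assms(2) by (simp add: field_simps)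
  then have "sqrt (real k / 2) * 4 \<le> sqrt (real k / 2) * (real n * sqrt \<epsilon>)"
    by (intro mult_left_mono) auto
  also have "\<dots> = real n * sqrt (real k * \<epsilon> / 2)"
    by (simp add: real_sqrt_mult real_sqrt_divide)
  finally have "sqrt (real k / 2)
      \<le> sqrt (next_z k \<epsilon> t) + real n * (sqrt (real k * \<epsilon> / 2) / 4)"
    using z(1) t(1) real_sqrt_ge_zero[of "next_z k \<epsilon> t"] by linarith
  then obtain L where L: "final_lines k \<epsilon> = Some L" "finite L" "card L \<le> card L1 + n"
    using loop_lines_bound[OF assms(2,3), of L1 k "next_z k \<epsilon> t" n] z
    by (auto simp: final_lines_def body L1_def)
  have "card L1 \<le> 2"
    by (simp add: L1_def card_insert_if)
  \<comment> \<open>The 3 counts at most two lines after the first pass and one for rounding up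
    \<open>n\<close>. It is absorbed below because sqrt \<epsilon> < 1.\<close>
  then have "real (card L) \<le> 4 / sqrt \<epsilon> + 3"
    using L(3) n(2) by linarith
  also have "\<dots> \<le> 7 / sqrt \<epsilon>"
    using assms by (simp add: field_simps)
  finally show ?thesis
    using L by blast
qed

theorem theorem10:
  shows "(\<forall>(k::nat) (\<epsilon>::real). 2 \<le> k \<and> 0 < \<epsilon> \<and> \<epsilon> < 1 \<longrightarrow>
            (\<exists>L. final_lines k \<epsilon> = Some L \<and> finite L)) \<and>
         (\<exists>C>0. \<exists>\<epsilon>\<^sub>0>0. \<epsilon>\<^sub>0 < 1 \<and>
            (\<forall>(k::nat) (\<epsilon>::real). 2 \<le> k \<and> 0 < \<epsilon> \<and> \<epsilon> < \<epsilon>\<^sub>0 \<longrightarrow>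
               (\<exists>L. final_lines k \<epsilon> = Some L \<and>
                    real (card L) \<le> C * (\<epsilon> powr (- 1 / 2) * ln (ln (1 / \<epsilon>))))))"
proof (intro conjI)
  show "\<forall>(k::nat) (\<epsilon>::real). 2 \<le> k \<and> 0 < \<epsilon> \<and> \<epsilon> < 1 \<longrightarrow>
          (\<exists>L. final_lines k \<epsilon> = Some L \<and> finite L)"
    using final_lines_bound by blast
  \<comment> \<open>Below the threshold \<open>exp (- exp 1)\<close> the double logarithm is at
    least 1, so inserting it only weakens the bound 7 / sqrt \<epsilon>.\<close>
  have "\<exists>L. final_lines k \<epsilon> = Some L \<and>
          real (card L) \<le> 7 * (\<epsilon> powr (- 1 / 2) * ln (ln (1 / \<epsilon>)))"
    if k: "2 \<le> k" and \<epsilon>: "0 < \<epsilon>" "\<epsilon> < exp (- exp 1)" for k :: nat and \<epsilon> :: real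
  proof -
    have "exp (- exp 1 :: real) < 1"
      by simp
    then have "\<epsilon> < 1"
      using \<epsilon> by linarith
    then obtain L where L: "final_lines k \<epsilon> = Some L" "real (card L) \<le> 7 / sqrt \<epsilon>"
      using final_lines_bound k \<epsilon>(1) by blast
    have "ln \<epsilon> \<le> - exp 1"
      using \<epsilon> ln_le_cancel_iff[of \<epsilon> "exp (- exp 1)"] by simp
    then have "exp 1 \<le> ln (1 / \<epsilon>)"
      using \<epsilon>(1) by (simp add: ln_div)
    moreover from this have "0 < ln (1 / \<epsilon>)"
      using exp_gt_zero[of "1 :: real"] by linarith
    ultimately have "1 \<le> ln (ln (1 / \<epsilon>))"
      by (simp add: ln_ge_iff)
    then have "7 * \<epsilon> powr (- 1 / 2) * 1 \<le> 7 * \<epsilon> powr (- 1 / 2) * ln (ln (1 / \<epsilon>))"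
      by (intro mult_left_mono) auto
    moreover have "\<epsilon> powr (- 1 / 2) = 1 / sqrt \<epsilon>"
      using \<epsilon>(1) powr_minus_divide[of \<epsilon> "1 / 2"] by (simp add: powr_half_sqrt)
    ultimately show ?thesis
      using L by (auto simp: mult.assoc)
  qed
  then show "\<exists>C>0. \<exists>\<epsilon>\<^sub>0>0. \<epsilon>\<^sub>0 < 1 \<and>
      (\<forall>(k::nat) (\<epsilon>::real). 2 \<le> k \<and> 0 < \<epsilon> \<and> \<epsilon> < \<epsilon>\<^sub>0 \<longrightarrow>
         (\<exists>L. final_lines k \<epsilon> = Some L \<and>
              real (card L) \<le> C * (\<epsilon> powr (- 1 / 2) * ln (ln (1 / \<epsilon>)))))"
    by (intro exI[of _ 7] conjI exI[of _ "exp (- exp 1)"]) auto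
qed

end
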